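(* Let $n\ge2$ and $\rho=(\text{F-code})^{-1}\circ\text{E-code}\colon D_n\to D_n$. Then for every $\sigma\in D_n$, $$inv_D(\sigma)=sor_D(\rho(\sigma))\qquad\text{and}\qquad nmin_D(\sigma)=\tilde l_D'(\rho(\sigma)).$$
   Context: $B_n$: bijections $\sigma$ of $\{\pm1,\ldots,\pm n\}$ with $\sigma(-i)=-\sigma(i)$, written $\sigma_1\cdots\sigma_n$, $\sigma_i=\sigma(i)$, composition as product; $D_n$: elements with an even number of negative entries; $\bar i=-i$; $\chi$ the indicator. $inv_D(\sigma)=|\{i<j:\sigma_i>\sigma_j\}|+|\{i<j:-\sigma_i>\sigma_j\}|$. $nmin_D(\sigma)=|\{i:\sigma_i>|\sigma_j|\text{ for some }j>i\}|+|\{i:\sigma_i<-1\}|$. Reflections $T^B$: $(i,j)$ for $1\le i<j\le n$ (exchanging $i,j$ and $-i,-j$), $(-i,j)$ for $1\le i<j\le n$ (exchanging $-i,j$ and $i,-j$), $(-j,j)$ for $1\le j\le n$ (exchanging $j,-j$). Each $\sigma\in D_n$ factors uniquely as $(i_1,j_1)\cdots(i_k,j_k)$ with factors in $T^B$ and $0<j_1<\cdots<j_k\le n$; $sor_D(\sigma)=\sum_r(j_r-i_r-2\chi(i_r<0))$. $T^D=\{(i,j):1\le|i|<j\le n\}\cup\{(-i,i)(-1,1):1<i\le n\}$; $\tilde l_D'(\sigma)$ is the minimal number of elements of $T^D$ with product $\sigma$. E-code: $\sigma^{(n)}=\sigma$; for $i=n,\ldots,2$, given $\sigma^{(i)}\in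 D_i$: if $i$ is at position $p$, $e_i=p$ and delete $i$; if $\bar i$ is at position $p$, $e_i=-p$, delete $\bar i$ and change the sign of the entry at the first position; $e_1=1$. F-code: $\sigma^{(n)}=\sigma$; for $i=n,\ldots,2$: if $\sigma^{(i)}(p)=i$, $f_i=p$ and exchange the entries at positions $p$ and $i$; if $\sigma^{(i)}(i)=\bar i$, $f_i=-i$ and change the signs of the entries at positions $i$ and $1$; if $\sigma^{(i)}(p)=\bar i$ with $p\neq i$, $f_i=-p$ and $\sigma^{(i-1)}=\sigma^{(i)}\circ(\bar p,i)$; $f_1=1$. Both the E-code and the F-code are bijections from $D_n$ onto the set of integer sequences $(c_1,\ldots,c_n)$ with $c_1=1$ and $c_r\in[-r,r]\setminus\{0\}$ for $r\ge2$, so $\rho$ is a well-defined bijection. *)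

theory Defs
  imports "HOL-Combinatorics.Permutations"
begin

(* Signed permutations are total functions on int that fix 0 and every integer of
   absolute value greater than n. *)
definition B :: "nat \<Rightarrow> (int \<Rightarrow> int) set" where
  "B n = {\<sigma>. \<sigma> permutes ({- int n..int n} - {0}) \<and> (\<forall>i. \<sigma> (- i) = - \<sigma> i)}"

definition D :: "nat \<Rightarrow> (int \<Rightarrow> int) set" where
  "D n = {\<sigma> \<in> B n. even (card {i \<in> {1..int n}. \<sigma> i < 0})}"

definition word :: "nat \<Rightarrow> (int \<Rightarrow> int) \<Rightarrow> int list" where
  "word n \<sigma> = map \<sigma> [1..int n]"

definition inv_D :: "nat \<Rightarrow> (int \<Rightarrow> int) \<Rightarrow> nat" where
  "inv_D n \<sigma> =
     card {(i, j). 1 \<le> i \<and> i < j \<and> j \<le> int n \<and> \<sigma> i > \<sigma> j} +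
     card {(i, j). 1 \<le> i \<and> i < j \<and> j \<le> int n \<and> - \<sigma> i > \<sigma> j}"

definition nmin_D :: "nat \<Rightarrow> (int \<Rightarrow> int) \<Rightarrow> nat" where
  "nmin_D n \<sigma> =
     card {i \<in> {1..int n}. \<exists>j. i < j \<and> j \<le> int n \<and> \<sigma> i > \<bar>\<sigma> j\<bar>} +
     card {i \<in> {1..int n}. \<sigma> i < - 1}"

(* srefl i j exchanges i with j and -i with -j.  With i = -j it exchanges j with -j only,
   and srefl j j is the identity. *)
definition srefl :: "int \<Rightarrow> int \<Rightarrow> int \<Rightarrow> int" where
  "srefl i j x =
     (if x = i then j else if x = j then i
      else if x = - i then - j else if x = - j then - i else x)"

definition comp_list :: "(int \<Rightarrow> int) list \<Rightarrow> int \<Rightarrow> int" where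
  "comp_list fs = foldr (\<circ>) fs id"

(* The reflections of type B, given by the pairs (i, j) naming them, since the sorting
   index refers to these pairs. *)
definition T_B :: "nat \<Rightarrow> (int \<times> int) set" where
  "T_B n = {(i, j). 1 \<le> i \<and> i < j \<and> j \<le> int n} \<union>
           {(- i, j) | i j. 1 \<le> i \<and> i < j \<and> j \<le> int n} \<union>
           {(- j, j) | j. 1 \<le> j \<and> j \<le> int n}"

definition sorting_factorization :: "nat \<Rightarrow> (int \<Rightarrow> int) \<Rightarrow> (int \<times> int) list \<Rightarrow> bool" where
  "sorting_factorization n \<sigma> ts \<longleftrightarrow>
     set ts \<subseteq> T_B n \<and> sorted_wrt (<) (map snd ts) \<and>
     \<sigma> = comp_list (map (\<lambda>(i, j). srefl i j) ts)"

definition sor_D :: "nat \<Rightarrow> (int \<Rightarrow> int) \<Rightarrow> int" where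
  "sor_D n \<sigma> =
     (\<Sum>(i, j) \<leftarrow> (THE ts. sorting_factorization n \<sigma> ts). j - i - 2 * of_bool (i < 0))"

definition T_D :: "nat \<Rightarrow> (int \<Rightarrow> int) set" where
  "T_D n = {srefl i j | i j. 1 \<le> \<bar>i\<bar> \<and> \<bar>i\<bar> < j \<and> j \<le> int n} \<union>
           {srefl (- i) i \<circ> srefl (- 1) 1 | i. 1 < i \<and> i \<le> int n}"

definition l_D :: "nat \<Rightarrow> (int \<Rightarrow> int) \<Rightarrow> nat" where
  "l_D n \<sigma> = (LEAST k. \<exists>ts. length ts = k \<and> set ts \<subseteq> T_D n \<and> \<sigma> = comp_list ts)"

(* Position of the first occurrence of x in w, counted from 1. *)
definition position :: "int \<Rightarrow> int list \<Rightarrow> nat" where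
  "position x w = Suc (length (takeWhile (\<lambda>y. y \<noteq> x) w))"

fun negate_first :: "int list \<Rightarrow> int list" where
  "negate_first [] = []"
| "negate_first (x # xs) = - x # xs"

(* In the barred case the sign change applies to the word left after the deletion: this keeps
   the number of negative entries even also when the deleted entry was the first one. *)
fun E_word :: "nat \<Rightarrow> int list \<Rightarrow> int list" where
  "E_word 0 w = []"
| "E_word (Suc 0) w = [1]"
| "E_word (Suc (Suc m)) w =
     (let i = int (Suc (Suc m)) in
      if i \<in> set w
      then E_word (Suc m) (remove1 i w) @ [int (position i w)]
      else E_word (Suc m) (negate_first (remove1 (- i) w)) @ [- int (position (- i) w)])"

definition E_code :: "nat \<Rightarrow> (int \<Rightarrow> int) \<Rightarrow> int list" where
  "E_code n \<sigma> = E_word n (word n \<sigma>)"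

(* Here q = p > 0 when i is at position p, and q = -p when -i is at position p, so in every
   case q is the code entry.  Composing with srefl q i on the right exchanges the entries at
   positions p and i if q = p, and is the composition with (-p, i) if q = -p; composing with
   srefl (-i) i o srefl (-1) 1 changes the signs of the entries at positions i and 1. *)
fun F_code :: "nat \<Rightarrow> (int \<Rightarrow> int) \<Rightarrow> int list" where
  "F_code 0 \<sigma> = []"
| "F_code (Suc 0) \<sigma> = [1]"
| "F_code (Suc (Suc m)) \<sigma> =
     (let i = int (Suc (Suc m)); q = inv \<sigma> i in
      F_code (Suc m)
        (if q = - i then \<sigma> \<circ> (srefl (- i) i \<circ> srefl (- 1) 1) else \<sigma> \<circ> srefl q i) @ [q])"

definition rho :: "nat \<Rightarrow> (int \<Rightarrow> int) \<Rightarrow> (int \<Rightarrow> int)" where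
  "rho n \<sigma> = the_inv_into (D n) (F_code n) (E_code n \<sigma>)"

end

(* Write s for the sign change at position 1. Every sigma in B_n has a sorting code: factor
   it as tau o srefl q n with tau in B_(n-1), record q, and repeat with tau. Both sor_D and the
   length with respect to T^D are sums of a local weight over this code. Multiplying sigma by s
   on the right only exchanges entries 1 and -1 of the code, which have equal weights; as the
   F-code differs from the sorting procedure only by such factors s, both statistics are also
   sums over the F-code. For the length this needs that a reflection increases the number of r > 1
   with entry different from r by at most one, which follows by pushing the reflection through
   the last factor of the sorting procedure. On the other side, inserting n or -n at position p
   of a word changes inv_D and nmin_D by the same weights, and both statistics are unaffected by
   s, so they are sums of these weights over the E-code. *)

theory Submission
  imports Defs
begin

section \<open>Signed permutations and reflections\<close>

lemma srefl_refl [simp]: "srefl j j = id"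
  by (auto simp: srefl_def fun_eq_iff)

lemma srefl_commute: "srefl i j = srefl j i"
  by (auto simp: srefl_def fun_eq_iff)

lemma srefl_minus: "i \<noteq> 0 \<Longrightarrow> j \<noteq> 0 \<Longrightarrow> srefl (- i) (- j) = srefl i j"
  by (auto simp: srefl_def fun_eq_iff)

lemma srefl_uminus: "srefl (- j) j x = (if \<bar>x\<bar> = \<bar>j\<bar> then - x else x)"
  by (auto simp: srefl_def)

lemma srefl_right [simp]: "srefl i j j = i"
  by (auto simp: srefl_def)

lemma srefl_left [simp]: "srefl i j i = j"
  by (auto simp: srefl_def)

lemma srefl_involutive [simp]:
  assumes "i \<noteq> 0" "j \<noteq> 0"
  shows "srefl i j (srefl i j x) = x"
  using assms by (auto simp: srefl_def)

lemma srefl_comp_srefl: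
  assumes "i \<noteq> 0" "j \<noteq> 0"
  shows "srefl i j \<circ> srefl i j = id"
  using assms by (simp add: fun_eq_iff)

lemma srefl_odd:
  assumes "i \<noteq> 0" "j \<noteq> 0"
  shows "srefl i j (- x) = - srefl i j x"
  using assms by (auto simp: srefl_def)

text \<open>\<open>srefl a b\<close> is injective and odd, so the equality tests that define
  \<open>srefl c d\<close> carry over to the images of \<open>c\<close> and \<open>d\<close>. This
  moves a reflection past a factor of the sorting procedure.\<close>

lemma srefl_conjugate:
  assumes "a \<noteq> 0" "b \<noteq> 0"
  shows "srefl a b \<circ> srefl c d = srefl (srefl a b c) (srefl a b d) \<circ> srefl a b"
proof
  fix x
  have eq: "srefl a b y = srefl a b z \<longleftrightarrow> y = z" for y z
    using assms srefl_involutive by metis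
  show "(srefl a b \<circ> srefl c d) x = (srefl (srefl a b c) (srefl a b d) \<circ> srefl a b) x"
    unfolding comp_apply srefl_def[of c] srefl_def[of "srefl a b c"] srefl_odd[OF assms, symmetric] eq
    by simp
qed

section \<open>Elementary facts on the group \<open>B n\<close>\<close>

lemma B_minus: "\<sigma> \<in> B n \<Longrightarrow> \<sigma> (- i) = - \<sigma> i"
  by (simp add: B_def)

lemma B_permutes: "\<sigma> \<in> B n \<Longrightarrow> \<sigma> permutes ({- int n..int n} - {0})"
  by (simp add: B_def)

lemma B_bij: "\<sigma> \<in> B n \<Longrightarrow> bij \<sigma>"
  using B_permutes permutes_bij by blast

lemma B_inj: "\<sigma> \<in> B n \<Longrightarrow> \<sigma> x = \<sigma> y \<longleftrightarrow> x = y"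
  using B_bij bij_is_inj injD by metis

lemma B_range: "\<sigma> \<in> B n \<Longrightarrow> 1 \<le> \<bar>\<sigma> i\<bar> \<and> \<bar>\<sigma> i\<bar> \<le> int n \<longleftrightarrow> 1 \<le> \<bar>i\<bar> \<and> \<bar>i\<bar> \<le> int n"
  using permutes_in_image[OF B_permutes, of \<sigma> n i] by auto

lemma B_fixes: "\<sigma> \<in> B n \<Longrightarrow> int n < \<bar>i\<bar> \<Longrightarrow> \<sigma> i = i"
  using permutes_not_in[OF B_permutes, of \<sigma> n i] by fastforce

lemma B_inv: "\<sigma> \<in> B n \<Longrightarrow> inv \<sigma> i = q \<longleftrightarrow> \<sigma> q = i"
  by (metis B_permutes permutes_inverses)

lemma id_in_B: "id \<in> B n"
  by (simp add: B_def permutes_id)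

lemma B_0: "B 0 = {id}"
  by (auto simp: B_def)

lemma B_comp: "\<sigma> \<in> B n \<Longrightarrow> \<tau> \<in> B n \<Longrightarrow> \<sigma> \<circ> \<tau> \<in> B n"
  by (auto simp: B_def intro: permutes_compose)

lemma srefl_in_B:
  assumes "1 \<le> \<bar>i\<bar>" "\<bar>i\<bar> \<le> int n" "1 \<le> \<bar>j\<bar>" "\<bar>j\<bar> \<le> int n"
  shows "srefl i j \<in> B n"
proof -
  have "srefl i j permutes ({- int n..int n} - {0})"
  proof (rule bij_imp_permutes)
    fix x assume "x \<notin> {- int n..int n} - {0}"
    then show "srefl i j x = x" using assms by (auto simp: srefl_def)
  next
    have inv: "\<And>x. srefl i j (srefl i j x) = x" using assms by simp
    have "x \<in> {- int n..int n} - {0} \<Longrightarrow> srefl i j x \<in> {- int n..int n} - {0}" for x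
      using assms by (auto simp: srefl_def)
    then show "bij_betw (srefl i j) ({- int n..int n} - {0}) ({- int n..int n} - {0})"
      using inv by (intro bij_betwI[where g = "srefl i j"]) auto
  qed
  then show ?thesis using assms by (auto simp: B_def srefl_def)
qed

section \<open>The recursion from \<open>B m\<close> to \<open>B (Suc m)\<close> by sorting\<close>

lemma B_Suc: "\<sigma> \<in> B m \<Longrightarrow> \<sigma> \<in> B (Suc m)"
  unfolding B_def by (auto intro: permutes_subset)

lemma B_SucD:
  assumes "\<sigma> \<in> B (Suc m)" "\<sigma> (int (Suc m)) = int (Suc m)"
  shows "\<sigma> \<in> B m"
proof -
  have "\<sigma> permutes ({- int m..int m} - {0})"
  proof (rule permutes_superset[OF B_permutes[OF assms(1)]])
    fix x assume "x \<in> {- int (Suc m)..int (Suc m)} - {0} - ({- int m..int m} - {0})"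
    then have "x = int (Suc m) \<or> x = - int (Suc m)" by auto
    then show "\<sigma> x = x" using assms B_minus by metis
  qed
  then show ?thesis using assms(1) by (auto simp: B_def)
qed

text \<open>One sorting step: \<open>q\<close> is the place of the value \<open>Suc m\<close>, and
  exchanging it with the place \<open>Suc m\<close> leaves a signed permutation that fixes
  \<open>Suc m\<close>. The factor is trivial when \<open>q\<close> is \<open>Suc m\<close>.\<close>

lemma B_Suc_decompose:
  assumes "\<sigma> \<in> B (Suc m)"
  obtains \<tau> q where "\<tau> \<in> B m" "1 \<le> \<bar>q\<bar>" "\<bar>q\<bar> \<le> int (Suc m)" "\<sigma> = \<tau> \<circ> srefl q (int (Suc m))"
proof -
  define q where "q = inv \<sigma> (int (Suc m))"
  have q: "\<sigma> q = int (Suc m)" using B_inv[OF assms] q_def by blast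
  have bd: "1 \<le> \<bar>q\<bar>" "\<bar>q\<bar> \<le> int (Suc m)"
    using B_range[OF assms, of q] q by auto
  have "\<sigma> \<circ> srefl q (int (Suc m)) \<in> B (Suc m)"
    using assms bd by (intro B_comp srefl_in_B) auto
  then have "\<sigma> \<circ> srefl q (int (Suc m)) \<in> B m"
    by (rule B_SucD) (simp add: q)
  moreover have "\<sigma> = \<sigma> \<circ> srefl q (int (Suc m)) \<circ> srefl q (int (Suc m))"
    using bd by (simp add: fun_eq_iff)
  ultimately show thesis using that bd by blast
qed

lemma B_induct [consumes 1, case_names zero Suc]:
  assumes "\<sigma> \<in> B n"
    and zero: "P 0 id"
    and Suc: "\<And>m \<tau> q. \<tau> \<in> B m \<Longrightarrow> 1 \<le> \<bar>q\<bar> \<Longrightarrow> \<bar>q\<bar> \<le> int (Suc m) \<Longrightarrow> P m \<tau> \<Longrightarrow>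
      P (Suc m) (\<tau> \<circ> srefl q (int (Suc m)))"
  shows "P n \<sigma>"
  using assms(1)
proof (induction n arbitrary: \<sigma>)
  case 0
  then show ?case using zero by (simp add: B_0 flip: id_def)
next
  case (Suc m)
  then show ?case using assms(3) B_Suc_decompose by metis
qed

lemma comp_srefl_in_B:
  assumes "\<tau> \<in> B m" "1 \<le> \<bar>q\<bar>" "\<bar>q\<bar> \<le> int (Suc m)"
  shows "\<tau> \<circ> srefl q (int (Suc m)) \<in> B (Suc m)"
  using assms by (intro B_comp srefl_in_B B_Suc) auto

lemma inv_comp_srefl:
  assumes "\<tau> \<in> B m" "1 \<le> \<bar>q\<bar>" "\<bar>q\<bar> \<le> int (Suc m)"
  shows "inv (\<tau> \<circ> srefl q (int (Suc m))) (int (Suc m)) = q"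
  unfolding B_inv[OF comp_srefl_in_B[OF assms]] using B_fixes[OF assms(1)] by simp

text \<open>The factor is read off from the preimage of \<open>Suc m\<close>, and being an
  involution it cancels.\<close>

lemma comp_srefl_unique:
  assumes "\<tau> \<in> B m" "1 \<le> \<bar>q\<bar>" "\<bar>q\<bar> \<le> int (Suc m)"
    and "\<tau>' \<in> B m" "1 \<le> \<bar>q'\<bar>" "\<bar>q'\<bar> \<le> int (Suc m)"
    and eq: "\<tau> \<circ> srefl q (int (Suc m)) = \<tau>' \<circ> srefl q' (int (Suc m))"
  shows "\<tau> = \<tau>' \<and> q = q'"
proof -
  have "q = q'" using inv_comp_srefl assms by metis
  moreover have "\<tau> \<circ> srefl q (int (Suc m)) \<circ> srefl q (int (Suc m)) = \<tau>"
    "\<tau>' \<circ> srefl q' (int (Suc m)) \<circ> srefl q' (int (Suc m)) = \<tau>'"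
    using assms by (auto simp: fun_eq_iff)
  ultimately show ?thesis using eq by metis
qed

section \<open>Even-signed permutations\<close>

lemma D_subset_B: "\<sigma> \<in> D n \<Longrightarrow> \<sigma> \<in> B n"
  by (simp add: D_def)

text \<open>Parity as a product of signs turns closure of \<open>D n\<close> under composition into
  a computation with products.\<close>

lemma D_iff_prod_sgn:
  assumes "\<sigma> \<in> B n"
  shows "\<sigma> \<in> D n \<longleftrightarrow> (\<Prod>i\<in>{1..int n}. sgn (\<sigma> i)) = 1"
proof -
  have "(\<Prod>i\<in>{1..int n}. sgn (\<sigma> i)) = (\<Prod>i\<in>{1..int n}. if \<sigma> i < 0 then -1 else 1)"
  proof (rule prod.cong[OF refl])
    fix i assume "i \<in> {1..int n}"
    then have "\<sigma> i \<noteq> 0" using B_range[OF assms, of i] by auto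
    then show "sgn (\<sigma> i) = (if \<sigma> i < 0 then -1 else 1)" by simp
  qed
  also have "\<dots> = (-1) ^ card {i \<in> {1..int n}. \<sigma> i < 0}"
    by (simp add: prod.If_cases Int_def)
  finally show ?thesis using assms
    by (simp add: D_def minus_one_power_iff)
qed

lemma D_comp:
  assumes "\<sigma> \<in> D n" "\<tau> \<in> D n"
  shows "\<sigma> \<circ> \<tau> \<in> D n"
proof -
  have \<sigma>: "\<sigma> \<in> B n" and \<tau>: "\<tau> \<in> B n" using assms D_subset_B by auto
  \<comment> \<open>By oddness the sign of \<open>\<sigma> (\<tau> i)\<close> is that of
    \<open>\<tau> i\<close> times that of \<open>\<sigma> \<bar>\<tau> i\<bar>\<close>, and
    \<open>\<bar>\<tau> i\<bar>\<close> runs once through \<open>{1..int n}\<close>.\<close>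
  have "inj_on (\<lambda>i. \<bar>\<tau> i\<bar>) {1..int n}"
  proof (rule inj_onI)
    fix x y assume xy: "x \<in> {1..int n}" "y \<in> {1..int n}" "\<bar>\<tau> x\<bar> = \<bar>\<tau> y\<bar>"
    then have "\<tau> x = \<tau> y \<or> \<tau> x = \<tau> (- y)" using B_minus[OF \<tau>] by (auto simp: abs_eq_iff)
    then show "x = y" using xy B_inj[OF \<tau>] by auto
  qed
  moreover have "(\<lambda>i. \<bar>\<tau> i\<bar>) ` {1..int n} \<subseteq> {1..int n}"
    using B_range[OF \<tau>] by fastforce
  ultimately have bij: "bij_betw (\<lambda>i. \<bar>\<tau> i\<bar>) {1..int n} {1..int n}"
    by (simp add: bij_betw_def endo_inj_surj)
  have "sgn (\<sigma> x) = sgn x * sgn (\<sigma> \<bar>x\<bar>)" if "x \<noteq> 0" for x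
    using B_minus[OF \<sigma>, of x] that by (cases "x < 0") (auto simp: sgn_minus)
  moreover have "\<tau> i \<noteq> 0" if "i \<in> {1..int n}" for i
    using B_range[OF \<tau>, of i] that by auto
  ultimately have "(\<Prod>i\<in>{1..int n}. sgn (\<sigma> (\<tau> i))) =
      (\<Prod>i\<in>{1..int n}. sgn (\<tau> i) * sgn (\<sigma> \<bar>\<tau> i\<bar>))"
    by (intro prod.cong refl) blast
  also have "\<dots> = (\<Prod>i\<in>{1..int n}. sgn (\<tau> i)) * (\<Prod>i\<in>{1..int n}. sgn (\<sigma> i))"
    unfolding prod.distrib using prod.reindex_bij_betw[OF bij, of "\<lambda>i. sgn (\<sigma> i)"] by simp
  also have "\<dots> = 1 * 1"
    using assms D_iff_prod_sgn \<sigma> \<tau> by metis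
  finally have "(\<Prod>i\<in>{1..int n}. sgn ((\<sigma> \<circ> \<tau>) i)) = 1" by simp
  then show ?thesis using D_iff_prod_sgn[OF B_comp[OF \<sigma> \<tau>]] by blast
qed

lemma id_in_D: "id \<in> D n"
  unfolding D_iff_prod_sgn[OF id_in_B] by (rule prod.neutral) simp

lemma D_1: "D (Suc 0) = {id}"
proof
  show "D (Suc 0) \<subseteq> {id}"
  proof
    fix \<sigma> assume \<sigma>: "\<sigma> \<in> D (Suc 0)"
    have B: "\<sigma> \<in> B (Suc 0)" using \<sigma> D_subset_B by blast
    have "sgn (\<sigma> 1) = 1" using \<sigma> D_iff_prod_sgn[OF B] by simp
    then have "\<sigma> 1 = 1" using B_range[OF B, of 1] by (auto simp: sgn_1_pos)
    then have "\<sigma> \<in> B 0" by (intro B_SucD[OF B]) simp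
    then show "\<sigma> \<in> {id}" by (simp add: B_0)
  qed
qed (simp add: id_in_D)

lemma D_Suc_iff:
  assumes "\<sigma> \<in> B m"
  shows "\<sigma> \<in> D (Suc m) \<longleftrightarrow> \<sigma> \<in> D m"
proof -
  have "\<sigma> (int (Suc m)) = int (Suc m)" using assms B_fixes by simp
  then have "{i \<in> {1..int (Suc m)}. \<sigma> i < 0} = {i \<in> {1..int m}. \<sigma> i < 0}"
    by (auto simp: le_less)
  then show ?thesis using assms B_Suc by (simp add: D_def)
qed

text \<open>The factor of one step of the F-code. It differs from the sorting factor only for
  \<open>q = - i\<close>, where a second sign change at position 1 keeps the number of negative
  entries even.\<close>

definition F_factor :: "int \<Rightarrow> int \<Rightarrow> int \<Rightarrow> int" where
  "F_factor q i = (if q = - i then srefl (- i) i \<circ> srefl (- 1) 1 else srefl q i)"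

lemma F_factor_involutive:
  assumes "q \<noteq> 0" "i > 1"
  shows "F_factor q i \<circ> F_factor q i = id"
proof (cases "q = - i")
  case True
  have "srefl (- i) i (srefl (- 1) 1 x) = (if \<bar>x\<bar> = i \<or> \<bar>x\<bar> = 1 then - x else x)" for x
    using assms unfolding srefl_uminus by simp
  then show ?thesis using True by (simp add: F_factor_def fun_eq_iff)
next
  case False
  then show ?thesis using assms by (simp add: F_factor_def srefl_comp_srefl)
qed

lemma F_factor_right: "i > 1 \<Longrightarrow> F_factor q i i = q"
  by (simp add: F_factor_def srefl_uminus)

lemma F_factor_in_D:
  assumes "1 \<le> \<bar>q\<bar>" "\<bar>q\<bar> \<le> i" "1 < i" "i \<le> int n"
  shows "F_factor q i \<in> D n"
proof -
  have B: "F_factor q i \<in> B n"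
    using assms by (auto simp: F_factor_def intro!: B_comp srefl_in_B)
  \<comment> \<open>Either no position or exactly two distinct ones carry a negative entry.\<close>
  have "{x \<in> {1..int n}. F_factor q i x < 0} =
      (if q = - i then {1, i} else if q < 0 then {- q, i} else {})"
    using assms by (auto simp: F_factor_def srefl_def split: if_splits)
  then have "even (card {x \<in> {1..int n}. F_factor q i x < 0})"
    using assms by (auto simp: card_insert_if)
  then show ?thesis using B by (simp add: D_def)
qed

lemma comp_F_factor_in_D:
  assumes "\<tau> \<in> D m" "m \<ge> 1" "1 \<le> \<bar>q\<bar>" "\<bar>q\<bar> \<le> int (Suc m)"
  shows "\<tau> \<circ> F_factor q (int (Suc m)) \<in> D (Suc m)"
proof (rule D_comp)
  show "\<tau> \<in> D (Suc m)" using assms D_subset_B D_Suc_iff by blast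
  show "F_factor q (int (Suc m)) \<in> D (Suc m)" using assms by (intro F_factor_in_D) auto
qed

text \<open>As for \<open>B\<close>, but the factor now lies in \<open>D (Suc m)\<close>, so
  multiplying by it stays among the even-signed permutations.\<close>

lemma D_Suc_decompose:
  assumes \<sigma>: "\<sigma> \<in> D (Suc m)" and "m \<ge> 1"
  obtains \<tau> q where "\<tau> \<in> D m" "1 \<le> \<bar>q\<bar>" "\<bar>q\<bar> \<le> int (Suc m)" "\<sigma> = \<tau> \<circ> F_factor q (int (Suc m))"
proof -
  have B: "\<sigma> \<in> B (Suc m)" using \<sigma> D_subset_B by blast
  define q where "q = inv \<sigma> (int (Suc m))"
  have q: "\<sigma> q = int (Suc m)" using B_inv[OF B] q_def by blast
  have bd: "1 \<le> \<bar>q\<bar>" "\<bar>q\<bar> \<le> int (Suc m)"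
    using B_range[OF B, of q] q by auto
  let ?t = "F_factor q (int (Suc m))"
  have D: "\<sigma> \<circ> ?t \<in> D (Suc m)"
    using assms bd by (intro D_comp F_factor_in_D) auto
  moreover have "\<sigma> \<circ> ?t \<in> B m"
    using D_subset_B[OF D] by (rule B_SucD) (use F_factor_right[of "int (Suc m)" q] assms q in simp)
  ultimately have "\<sigma> \<circ> ?t \<in> D m" using D_Suc_iff by blast
  moreover have "\<sigma> = \<sigma> \<circ> ?t \<circ> ?t"
    using F_factor_involutive[of q "int (Suc m)"] bd assms by (simp add: comp_assoc)
  ultimately show thesis using that bd by blast
qed

text \<open>The induction starts at rank 1 because \<open>F_factor\<close> needs position 1 to be
  distinct from the top position.\<close>

lemma D_induct [consumes 2, case_names one Suc]:
  assumes "\<sigma> \<in> D n" "n \<ge> 1"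
    and one: "P (Suc 0) id"
    and Suc: "\<And>m \<tau> q. \<tau> \<in> D m \<Longrightarrow> m \<ge> 1 \<Longrightarrow> 1 \<le> \<bar>q\<bar> \<Longrightarrow> \<bar>q\<bar> \<le> int (Suc m) \<Longrightarrow> P m \<tau> \<Longrightarrow>
      P (Suc m) (\<tau> \<circ> F_factor q (int (Suc m)))"
  shows "P n \<sigma>"
  using assms(2,1)
proof (induction n arbitrary: \<sigma> rule: nat_induct_at_least)
  case base
  then show ?case using one by (simp add: D_1 flip: id_def)
next
  case (Suc m)
  then show ?case using assms(4) D_Suc_decompose by metis
qed

lemma F_code_Suc_Suc:
  "F_code (Suc (Suc k)) \<sigma> =
     (let i = int (Suc (Suc k)); q = inv \<sigma> i in F_code (Suc k) (\<sigma> \<circ> F_factor q i) @ [q])"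
  unfolding F_code.simps Let_def F_factor_def by (simp only: if_distrib)

text \<open>The F-code read backwards: \<open>\<tau>\<close> fixes \<open>Suc m\<close> and the
  factor maps \<open>q\<close> to \<open>Suc m\<close>, so the recursion finds \<open>q\<close> and
  then cancels the factor.\<close>

lemma F_code_comp_F_factor:
  assumes "\<tau> \<in> D m" "m \<ge> 1" "1 \<le> \<bar>q\<bar>" "\<bar>q\<bar> \<le> int (Suc m)"
  shows "F_code (Suc m) (\<tau> \<circ> F_factor q (int (Suc m))) = F_code m \<tau> @ [q]"
proof -
  let ?i = "int (Suc m)"
  let ?\<sigma> = "\<tau> \<circ> F_factor q ?i"
  obtain k where k: "m = Suc k" using assms(2) by (cases m) auto
  have inv2: "?\<sigma> \<circ> F_factor q ?i = \<tau>"
    using F_factor_involutive[of q ?i] assms by (simp add: comp_assoc)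
  have "F_factor q ?i (F_factor q ?i ?i) = ?i"
    using F_factor_involutive[of q ?i] assms by (simp add: fun_eq_iff del: of_nat_Suc)
  then have "F_factor q ?i q = ?i" using F_factor_right[of ?i q] assms by simp
  then have "?\<sigma> q = ?i" using B_fixes[of \<tau> m ?i] D_subset_B[OF assms(1)] by simp
  then have "inv ?\<sigma> ?i = q"
    using B_inv D_subset_B[OF comp_F_factor_in_D[OF assms]] by blast
  moreover have "F_code (Suc m) ?\<sigma> = F_code m (?\<sigma> \<circ> F_factor (inv ?\<sigma> ?i) ?i) @ [inv ?\<sigma> ?i]"
    unfolding k F_code_Suc_Suc Let_def ..
  ultimately show ?thesis using inv2 by simp
qed

text \<open>With this, \<open>the_inv_into\<close> in \<open>rho\<close> returns the preimage once
  one is known; preimages of E-codes are built in \<open>E_word_eq_F_code\<close>.\<close>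

lemma F_code_inj_on:
  assumes "n \<ge> 1"
  shows "inj_on (F_code n) (D n)"
proof -
  have "\<forall>\<sigma>'\<in>D n. F_code n \<sigma> = F_code n \<sigma>' \<longrightarrow> \<sigma> = \<sigma>'" if "\<sigma> \<in> D n" for \<sigma>
    using that assms
  proof (induction rule: D_induct)
    case one
    then show ?case by (simp add: D_1)
  next
    case (Suc m \<tau> q)
    show ?case
    proof (intro ballI impI)
      fix \<sigma>' assume "\<sigma>' \<in> D (Suc m)"
        and eq: "F_code (Suc m) (\<tau> \<circ> F_factor q (int (Suc m))) = F_code (Suc m) \<sigma>'"
      then obtain \<tau>' q' where "\<tau>' \<in> D m" "1 \<le> \<bar>q'\<bar>" "\<bar>q'\<bar> \<le> int (Suc m)"
        "\<sigma>' = \<tau>' \<circ> F_factor q' (int (Suc m))"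
        using D_Suc_decompose Suc by metis
      then show "\<tau> \<circ> F_factor q (int (Suc m)) = \<sigma>'"
        using eq Suc by (simp add: F_code_comp_F_factor del: of_nat_Suc F_code.simps)
    qed
  qed
  then show ?thesis by (auto intro: inj_onI)
qed

section \<open>Statistics that are sums over the sorting code\<close>

text \<open>At level \<open>r\<close> the entry \<open>q\<close> is the place of the value
  \<open>r\<close> once all larger values are in place; these entries form the sorting code. The
  weight is left arbitrary so that sorting index and length share the lemmas below.\<close>

fun sort_sum :: "(nat \<Rightarrow> int \<Rightarrow> int) \<Rightarrow> nat \<Rightarrow> (int \<Rightarrow> int) \<Rightarrow> int" where
  "sort_sum f 0 \<sigma> = 0"
| "sort_sum f (Suc m) \<sigma> =
     (let i = int (Suc m); q = inv \<sigma> i in f (Suc m) q + sort_sum f m (\<sigma> \<circ> srefl q i))"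

lemma sort_sum_comp_srefl:
  assumes "\<tau> \<in> B m" "1 \<le> \<bar>q\<bar>" "\<bar>q\<bar> \<le> int (Suc m)"
  shows "sort_sum f (Suc m) (\<tau> \<circ> srefl q (int (Suc m))) = f (Suc m) q + sort_sum f m \<tau>"
proof -
  have "\<tau> \<circ> srefl q (int (Suc m)) \<circ> srefl q (int (Suc m)) = \<tau>"
    using assms by (simp add: fun_eq_iff)
  then show ?thesis
    unfolding sort_sum.simps Let_def inv_comp_srefl[OF assms] by simp
qed

lemma sort_sum_id:
  assumes "\<And>m. m \<le> n \<Longrightarrow> f m (int m) = 0"
  shows "sort_sum f n id = 0"
  using assms
proof (induction n)
  case (Suc m)
  then show ?case using sort_sum_comp_srefl[OF id_in_B, of "int (Suc m)" m f]
    by (simp del: sort_sum.simps(2) of_nat_Suc flip: id_def)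
qed simp

text \<open>In rank above 1 the sign change moves from the right of the last factor to its left if
  \<open>q\<close> is replaced by its image. This alters \<open>q\<close> only when it is 1 or -1,
  where the weights agree, and the induction hypothesis absorbs the sign change.\<close>

lemma sort_sum_comp_neg1:
  assumes "\<sigma> \<in> B n" "n \<ge> 1" and f: "\<And>m. f m (- 1) = f m 1"
  shows "sort_sum f n (\<sigma> \<circ> srefl (- 1) 1) = sort_sum f n \<sigma>"
proof -
  have "n \<ge> 1 \<longrightarrow> sort_sum f n (\<sigma> \<circ> srefl (- 1) 1) = sort_sum f n \<sigma>"
    using assms(1)
  proof (induction rule: B_induct)
    case (Suc m \<tau> q)
    let ?s = "srefl (- 1) 1" and ?i = "int (Suc m)"
    have fs: "f k (?s q) = f k q" for k using f by (auto simp: srefl_def)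
    have bd: "1 \<le> \<bar>?s q\<bar>" "\<bar>?s q\<bar> \<le> ?i" using Suc by (auto simp: srefl_def)
    show ?case
    proof (cases "m = 0")
      case True
      \<comment> \<open>In rank 1 the factor is itself the identity or the sign change, so the
        product is again such a factor.\<close>
      then have "q = 1 \<or> q = - 1" using Suc by auto
      then have "srefl q ?i \<circ> ?s = srefl (?s q) ?i"
        using True by (auto simp: srefl_def fun_eq_iff)
      then have "\<tau> \<circ> srefl q ?i \<circ> ?s = \<tau> \<circ> srefl (?s q) ?i" by (simp add: comp_assoc)
      then show ?thesis
        using sort_sum_comp_srefl[of \<tau> m "?s q" f] sort_sum_comp_srefl[of \<tau> m q f] Suc.hyps bd fs
        by metis
    next
      case False
      then have "srefl q ?i \<circ> ?s = ?s \<circ> srefl (?s q) ?i"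
        by (auto simp: srefl_def fun_eq_iff)
      then have "\<tau> \<circ> srefl q ?i \<circ> ?s = (\<tau> \<circ> ?s) \<circ> srefl (?s q) ?i" by (simp add: comp_assoc)
      moreover have "\<tau> \<circ> ?s \<in> B m" using Suc False by (intro B_comp srefl_in_B) auto
      moreover have "sort_sum f m (\<tau> \<circ> ?s) = sort_sum f m \<tau>" using Suc.IH False by linarith
      ultimately show ?thesis
        using sort_sum_comp_srefl[of "\<tau> \<circ> ?s" m "?s q" f] sort_sum_comp_srefl[of \<tau> m q f]
          Suc.hyps bd fs
        by metis
    qed
  qed simp
  then show ?thesis using assms by blast
qed

text \<open>For \<open>q = - int (Suc m)\<close> the F-code factor is the sorting factor with the
  sign change at 1 on its right, which \<open>sort_sum_comp_neg1\<close> absorbs. So these sums can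
  be computed along the F-code.\<close>

lemma sort_sum_comp_F_factor:
  assumes "\<tau> \<in> B m" "m \<ge> 1" "1 \<le> \<bar>q\<bar>" "\<bar>q\<bar> \<le> int (Suc m)" and f: "\<And>m. f m (- 1) = f m 1"
  shows "sort_sum f (Suc m) (\<tau> \<circ> F_factor q (int (Suc m))) = f (Suc m) q + sort_sum f m \<tau>"
proof (cases "q = - int (Suc m)")
  case True
  have "F_factor q (int (Suc m)) = srefl q (int (Suc m)) \<circ> srefl (- 1) 1"
    using True by (simp add: F_factor_def)
  then have "\<tau> \<circ> F_factor q (int (Suc m)) = \<tau> \<circ> srefl q (int (Suc m)) \<circ> srefl (- 1) 1"
    by (simp only: comp_assoc)
  moreover have "sort_sum f (Suc m) \<dots> = sort_sum f (Suc m) (\<tau> \<circ> srefl q (int (Suc m)))"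
    using assms by (intro sort_sum_comp_neg1 comp_srefl_in_B) auto
  ultimately show ?thesis using sort_sum_comp_srefl assms by metis
next
  case False
  then show ?thesis using sort_sum_comp_srefl[of \<tau> m q f] assms
    by (simp only: F_factor_def if_False)
qed

section \<open>The sorting index\<close>

text \<open>The contribution of the factor \<open>(q, r)\<close> to \<open>sor_D\<close>. It
  vanishes at \<open>q = r\<close>, the trivial factor absent from factorizations, and the
  correction for negative \<open>q\<close> makes the values at 1 and -1 agree.\<close>

definition sor_weight :: "nat \<Rightarrow> int \<Rightarrow> int" where
  "sor_weight r q = int r - q - 2 * of_bool (q < 0)"

section \<open>Factorizations into reflections of type B\<close>

lemma comp_list_append: "comp_list (xs @ ys) = comp_list xs \<circ> comp_list ys"
  by (induction xs) (auto simp: comp_list_def)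

lemma comp_list_simps [simp]: "comp_list [] = id" "comp_list (f # fs) = f \<circ> comp_list fs"
  by (auto simp: comp_list_def)

lemma comp_list_in_B: "set fs \<subseteq> B n \<Longrightarrow> comp_list fs \<in> B n"
  by (induction fs) (auto simp: id_in_B B_comp)

lemma T_B_iff: "(i, j) \<in> T_B n \<longleftrightarrow> 1 \<le> \<bar>i\<bar> \<and> \<bar>i\<bar> \<le> j \<and> i \<noteq> j \<and> j \<le> int n"
proof
  assume ij: "1 \<le> \<bar>i\<bar> \<and> \<bar>i\<bar> \<le> j \<and> i \<noteq> j \<and> j \<le> int n"
  then consider "1 \<le> i" "i < j" | "i = - j" | "1 \<le> - i" "- i < j" by linarith
  then show "(i, j) \<in> T_B n"
  proof cases
    case 3
    then have "\<exists>k l. (i, j) = (- k, l) \<and> 1 \<le> k \<and> k < l \<and> l \<le> int n"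
      using ij by (intro exI[of _ "- i"] exI[of _ j]) simp
    then show ?thesis unfolding T_B_def by blast
  qed (use ij in \<open>auto simp: T_B_def\<close>)
qed (auto simp: T_B_def)

lemma sorting_factorization_in_B:
  assumes "sorting_factorization n \<sigma> ts"
  shows "\<sigma> \<in> B n"
proof -
  have "srefl i j \<in> B n" if "(i, j) \<in> set ts" for i j
  proof -
    have "(i, j) \<in> T_B n" using assms that by (auto simp: sorting_factorization_def)
    then show ?thesis by (intro srefl_in_B) (auto simp: T_B_iff)
  qed
  then have "set (map (\<lambda>(i, j). srefl i j) ts) \<subseteq> B n" by auto
  then show ?thesis using assms comp_list_in_B by (auto simp: sorting_factorization_def)
qed

text \<open>Second components increase strictly, so \<open>Suc m\<close> can occur among them only
  once, in the last factor; the alternatives distinguish whether it occurs.\<close>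

lemma sorting_factorization_Suc:
  "sorting_factorization (Suc m) \<sigma> ts \<longleftrightarrow>
     sorting_factorization m \<sigma> ts \<or>
     (\<exists>us \<tau> q. sorting_factorization m \<tau> us \<and> ts = us @ [(q, int (Suc m))] \<and>
        1 \<le> \<bar>q\<bar> \<and> \<bar>q\<bar> \<le> int (Suc m) \<and> q \<noteq> int (Suc m) \<and> \<sigma> = \<tau> \<circ> srefl q (int (Suc m)))"
  (is "?L \<longleftrightarrow> ?R1 \<or> ?R2")
proof
  assume L: ?L
  show "?R1 \<or> ?R2"
  proof (cases "int (Suc m) \<in> snd ` set ts")
    case False
    have "(i, j) \<in> T_B m" if "(i, j) \<in> set ts" for i j
    proof -
      have "j \<noteq> int (Suc m)" using False that by force
      moreover have "(i, j) \<in> T_B (Suc m)" using L that by (auto simp: sorting_factorization_def)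
      ultimately show ?thesis by (auto simp: T_B_iff)
    qed
    then show ?thesis using L by (auto simp: sorting_factorization_def)
  next
    case True
    then obtain q us vs where ts: "ts = us @ (q, int (Suc m)) # vs"
      by (metis (no_types, lifting) imageE prod.collapse split_list)
    \<comment> \<open>A later factor would need a second component above \<open>Suc m\<close>, which
      \<open>T_B\<close> excludes.\<close>
    have "(i, j) \<in> T_B (Suc m) \<and> int (Suc m) < j" if "(i, j) \<in> set vs" for i j
      using L that unfolding ts sorting_factorization_def
      by (auto simp: sorted_wrt_append)
    then have vs: "vs = []"
      by (cases vs) (fastforce simp: T_B_iff)+
    have "(i, j) \<in> T_B m" if "(i, j) \<in> set us" for i j
    proof -
      have "j < int (Suc m)"
        using L that by (fastforce simp: ts sorting_factorization_def sorted_wrt_append)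
      moreover have "(i, j) \<in> T_B (Suc m)"
        using L that by (auto simp: ts sorting_factorization_def)
      ultimately show ?thesis by (auto simp: T_B_iff)
    qed
    then have "sorting_factorization m (comp_list (map (\<lambda>(i, j). srefl i j) us)) us"
      using L by (auto simp: sorting_factorization_def ts sorted_wrt_append)
    moreover have "\<sigma> = comp_list (map (\<lambda>(i, j). srefl i j) us) \<circ> srefl q (int (Suc m))"
      using L by (simp add: sorting_factorization_def ts vs comp_list_append)
    moreover have "(q, int (Suc m)) \<in> T_B (Suc m)"
      using L by (simp add: sorting_factorization_def ts)
    ultimately show ?thesis using ts vs T_B_iff by blast
  qed
next
  have mono: "T_B m \<subseteq> T_B (Suc m)" by (auto simp: T_B_iff)
  assume "?R1 \<or> ?R2"
  then show ?L
  proof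
    assume ?R1
    then show ?L using mono by (auto simp: sorting_factorization_def)
  next
    assume ?R2
    then obtain us \<tau> q where u: "sorting_factorization m \<tau> us" "ts = us @ [(q, int (Suc m))]"
      "(q, int (Suc m)) \<in> T_B (Suc m)" "\<sigma> = \<tau> \<circ> srefl q (int (Suc m))"
      by (auto simp: T_B_iff)
    have "\<forall>p\<in>set us. snd p < int (Suc m)"
      using u(1) by (fastforce simp: sorting_factorization_def T_B_iff)
    then show ?L
      using u mono by (auto simp: sorting_factorization_def sorted_wrt_append comp_list_append)
  qed
qed

text \<open>The unique factorization is the sorting code with its trivial factors dropped; existence
  and uniqueness are proved together to evaluate the \<open>THE\<close> in
  \<open>sor_D\<close>.\<close>

lemma sor_D_eq_sort_sum:
  assumes "\<sigma> \<in> B n"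
  shows "sor_D n \<sigma> = sort_sum sor_weight n \<sigma>"
proof -
  let ?w = "\<lambda>ts. \<Sum>(i, j) \<leftarrow> ts. j - i - 2 * of_bool (i < 0) :: int"
  have "\<exists>us. (\<forall>ts. sorting_factorization n \<sigma> ts \<longleftrightarrow> ts = us) \<and> ?w us = sort_sum sor_weight n \<sigma>"
    using assms
  proof (induction rule: B_induct)
    case zero
    have "T_B 0 = {}" by (auto simp: T_B_def)
    then have "sorting_factorization 0 id ts \<longleftrightarrow> ts = []" for ts
      by (auto simp: sorting_factorization_def)
    then show ?case by (intro exI[of _ "[]"]) (simp flip: id_def)
  next
    case (Suc m \<tau> q)
    let ?i = "int (Suc m)"
    obtain us where us: "\<And>ts. sorting_factorization m \<tau> ts \<longleftrightarrow> ts = us"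
      and w: "?w us = sort_sum sor_weight m \<tau>" using Suc by blast
    have uniq: "\<tau>' \<circ> srefl q' ?i = \<tau> \<circ> srefl q ?i \<longleftrightarrow> \<tau>' = \<tau> \<and> q' = q"
      if "\<tau>' \<in> B m" "1 \<le> \<bar>q'\<bar>" "\<bar>q'\<bar> \<le> ?i" for \<tau>' q'
      using comp_srefl_unique[OF that Suc.hyps(1-3)] by blast
    \<comment> \<open>A factorization of rank \<open>m\<close> puts the product into
      \<open>B m\<close>, and uniqueness of the last factor then forces it to be trivial.\<close>
    have 1: "sorting_factorization m (\<tau> \<circ> srefl q ?i) ts \<longleftrightarrow> q = ?i \<and> ts = us" for ts
    proof
      assume s: "sorting_factorization m (\<tau> \<circ> srefl q ?i) ts"
      then have "\<tau> \<circ> srefl q ?i \<in> B m" by (rule sorting_factorization_in_B)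
      then have "\<tau> \<circ> srefl q ?i = \<tau> \<and> ?i = q"
        using uniq[of "\<tau> \<circ> srefl q ?i" ?i] by simp
      then show "q = ?i \<and> ts = us" using s us by metis
    qed (use us in simp)
    have 2: "(\<exists>vs \<tau>' q'. sorting_factorization m \<tau>' vs \<and> ts = vs @ [(q', ?i)] \<and>
        1 \<le> \<bar>q'\<bar> \<and> \<bar>q'\<bar> \<le> ?i \<and> q' \<noteq> ?i \<and> \<tau> \<circ> srefl q ?i = \<tau>' \<circ> srefl q' ?i) \<longleftrightarrow>
        q \<noteq> ?i \<and> ts = us @ [(q, ?i)]"
      (is "?E \<longleftrightarrow> _") for ts
    proof
      assume ?E
      then obtain vs \<tau>' q' where v: "sorting_factorization m \<tau>' vs" "ts = vs @ [(q', ?i)]"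
        "1 \<le> \<bar>q'\<bar>" "\<bar>q'\<bar> \<le> ?i" "q' \<noteq> ?i" "\<tau> \<circ> srefl q ?i = \<tau>' \<circ> srefl q' ?i"
        by blast
      then have "\<tau>' = \<tau> \<and> q' = q" using uniq[of \<tau>' q'] sorting_factorization_in_B by metis
      then show "q \<noteq> ?i \<and> ts = us @ [(q, ?i)]" using v us by auto
    qed (use us Suc.hyps in blast)
    have "sorting_factorization (Suc m) (\<tau> \<circ> srefl q ?i) ts \<longleftrightarrow>
        ts = us @ (if q = ?i then [] else [(q, ?i)])" for ts
      unfolding sorting_factorization_Suc 1 2 by auto
    moreover have "?w (us @ (if q = ?i then [] else [(q, ?i)])) =
        sort_sum sor_weight (Suc m) (\<tau> \<circ> srefl q ?i)"
      using sort_sum_comp_srefl[of \<tau> m q sor_weight] Suc w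
      by (auto simp: sor_weight_def simp del: sort_sum.simps(2))
    ultimately show ?case by blast
  qed
  then obtain us where "\<And>ts. sorting_factorization n \<sigma> ts \<longleftrightarrow> ts = us"
    and "?w us = sort_sum sor_weight n \<sigma>" by blast
  then show ?thesis by (simp add: sor_D_def)
qed

section \<open>The reflection length\<close>

text \<open>The index 1 is left out so that the sum over the sorting code is invariant under the sign change
  at position 1, which occurs as a factor in some elements of \<open>T_D\<close>.\<close>

definition moved :: "nat \<Rightarrow> int \<Rightarrow> int" where
  "moved r q = of_bool (r \<noteq> 1 \<and> q \<noteq> int r)"

text \<open>Both factors exchange \<open>a\<close> and \<open>i\<close> up to sign; together they
  restore the places and reverse both signs.\<close>

lemma srefl_comp_srefl_minus:
  assumes "1 \<le> \<bar>a\<bar>" "\<bar>a\<bar> < i"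
  shows "srefl a i \<circ> srefl (- a) i = srefl (- a) a \<circ> srefl (- i) i"
proof
  fix x
  have ne: "a \<noteq> i" "i \<noteq> a" "- a \<noteq> i" "i \<noteq> - a" "a \<noteq> 0" "i \<noteq> 0" "\<bar>i\<bar> = i" "\<bar>a\<bar> \<noteq> i"
    using assms by auto
  show "(srefl a i \<circ> srefl (- a) i) x = (srefl (- a) a \<circ> srefl (- i) i) x"
  proof (cases "\<bar>x\<bar> = \<bar>a\<bar> \<or> \<bar>x\<bar> = i")
    case True
    then consider "x = a" | "x = - a" | "x = i" | "x = - i" by linarith
    then show ?thesis
      by cases (use ne in \<open>simp_all add: srefl_uminus srefl_def[of a i] srefl_def[of "- a" i]\<close>)
  next
    case False
    then have "x \<noteq> a" "x \<noteq> - a" "x \<noteq> i" "x \<noteq> - i" using ne by auto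
    then show ?thesis
      using False ne by (simp add: srefl_uminus srefl_def[of a i] srefl_def[of "- a" i])
  qed
qed

text \<open>The last factor of the sorting procedure, multiplied by a further reflection, is again such a
  factor, preceded by a reflection of smaller rank or by the identity (\<open>a' = b'\<close>).\<close>

lemma srefl_comp_srefl_exchange:
  assumes "1 < i" "1 \<le> \<bar>q\<bar>" "\<bar>q\<bar> \<le> i" "1 \<le> \<bar>a\<bar>" "\<bar>a\<bar> \<le> i"
  obtains q' a' b' where "srefl q i \<circ> srefl a i = srefl a' b' \<circ> srefl q' i"
    "1 \<le> \<bar>q'\<bar>" "\<bar>q'\<bar> \<le> i" "1 \<le> \<bar>a'\<bar>" "\<bar>a'\<bar> < i" "1 \<le> \<bar>b'\<bar>" "\<bar>b'\<bar> < i"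
    "of_bool (q' \<noteq> i) + of_bool (a' \<noteq> b') \<le> (of_bool (q \<noteq> i) + of_bool (a \<noteq> i) :: int)"
proof -
  consider "q = i" | "a = i" | "q = a" "a \<noteq> i" | "q = - a" "\<bar>q\<bar> < i" | "a = - i" "\<bar>q\<bar> < i"
    | "q = - i" "\<bar>a\<bar> < i" | "\<bar>q\<bar> \<noteq> \<bar>a\<bar>" "\<bar>q\<bar> < i" "\<bar>a\<bar> < i"
    using assms by linarith
  then show thesis
  proof cases
    case 1
    then show thesis using assms by (intro that[of 1 1 a]) auto
  next
    case 2
    then show thesis using assms by (intro that[of 1 1 q]) auto
  next
    case 3
    then show thesis using assms by (intro that[of 1 1 i]) (auto simp: srefl_comp_srefl)
  next
    case 4
    then have "srefl q i \<circ> srefl a i = srefl (- q) q \<circ> srefl (- i) i"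
      using srefl_comp_srefl_minus[of "- a" i] assms by simp
    then show thesis by (rule that) (use 4 assms in auto)
  next
    case 5
    \<comment> \<open>Conjugation turns the sign change at \<open>i\<close> into the one at
      \<open>\<bar>q\<bar>\<close>.\<close>
    have "srefl q i (- i) = - q" using 5 assms by (simp add: srefl_def)
    then have "srefl q i \<circ> srefl a i = srefl (- q) q \<circ> srefl q i"
      using srefl_conjugate[of q i a i] 5 assms by simp
    then show thesis by (rule that) (use 5 assms in auto)
  next
    case 6
    have ne: "- a \<noteq> 0" "i \<noteq> 0" "- i \<noteq> 0" using assms by auto
    \<comment> \<open>The double sign change is solved for the product wanted:
      \<open>srefl (- a) i\<close> moves to the other side, and the two sign changes
      commute.\<close>
    have "srefl a i \<circ> srefl (- a) i = srefl (- a) a \<circ> srefl (- i) i"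
      using assms(4) 6(2) by (rule srefl_comp_srefl_minus)
    then have eq: "srefl a i (srefl (- a) i x) = srefl (- a) a (srefl (- i) i x)" for x
      by (metis comp_apply)
    have "srefl (- i) i (srefl (- a) a x) = srefl (- a) a (srefl (- i) i x)" for x
      by (simp add: srefl_uminus)
    then have "srefl (- i) i (srefl a i x) = srefl (- a) a (srefl (- a) i x)" for x
      using eq[of "srefl (- a) i x"] srefl_involutive ne by metis
    then have "srefl q i \<circ> srefl a i = srefl (- a) a \<circ> srefl (- a) i"
      unfolding 6(1) fun_eq_iff comp_apply by blast
    then show thesis by (rule that) (use 6 assms in auto)
  next
    case 7
    then have "srefl q i a = a" using assms by (auto simp: srefl_def)
    then have "srefl q i \<circ> srefl a i = srefl a q \<circ> srefl q i"
      using srefl_conjugate[of q i a i] 7 assms by simp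
    then show thesis by (rule that) (use 7 assms in auto)
  qed
qed

text \<open>A reflection involving the top index is treated by
  \<open>srefl_comp_srefl_exchange\<close>, any other one passes the last factor; what remains on
  the left has smaller rank and falls under the induction hypothesis. The case \<open>a = b\<close>
  covers the identity that the exchange may leave.\<close>

lemma sort_sum_moved_comp_srefl:
  assumes "\<sigma> \<in> B n" "1 \<le> \<bar>a\<bar>" "\<bar>a\<bar> \<le> int n" "1 \<le> \<bar>b\<bar>" "\<bar>b\<bar> \<le> int n"
  shows "sort_sum moved n (\<sigma> \<circ> srefl a b) \<le> sort_sum moved n \<sigma> + of_bool (a \<noteq> b)"
proof -
  have "\<forall>a b. 1 \<le> \<bar>a\<bar> \<longrightarrow> \<bar>a\<bar> \<le> int n \<longrightarrow> 1 \<le> \<bar>b\<bar> \<longrightarrow> \<bar>b\<bar> \<le> int n \<longrightarrow>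
     sort_sum moved n (\<sigma> \<circ> srefl a b) \<le> sort_sum moved n \<sigma> + of_bool (a \<noteq> b)"
    using assms(1)
  proof (induction rule: B_induct)
    case zero
    then show ?case by auto
  next
    case (Suc m \<tau> q)
    let ?i = "int (Suc m)"
    have S: "sort_sum moved (Suc m) (\<tau>' \<circ> srefl q' ?i) = moved (Suc m) q' + sort_sum moved m \<tau>'"
      if "\<tau>' \<in> B m" "1 \<le> \<bar>q'\<bar>" "\<bar>q'\<bar> \<le> ?i" for \<tau>' q'
      using sort_sum_comp_srefl that by blast
    have IH: "sort_sum moved m (\<tau> \<circ> srefl a b) \<le> sort_sum moved m \<tau> + of_bool (a \<noteq> b)"
      if "1 \<le> \<bar>a\<bar>" "\<bar>a\<bar> \<le> int m" "1 \<le> \<bar>b\<bar>" "\<bar>b\<bar> \<le> int m" for a b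
      using Suc that by blast
    \<comment> \<open>Every reflection involving \<open>Suc m\<close> or its negative can be written
      with second index \<open>Suc m\<close>, by symmetry and by negating both indices.\<close>
    have top: "sort_sum moved (Suc m) (\<tau> \<circ> srefl q ?i \<circ> srefl a ?i)
        \<le> sort_sum moved (Suc m) (\<tau> \<circ> srefl q ?i) + of_bool (a \<noteq> ?i)"
      if a: "1 \<le> \<bar>a\<bar>" "\<bar>a\<bar> \<le> ?i" for a
    proof (cases "m = 0")
      case True
      \<comment> \<open>The exchange requires \<open>1 < i\<close>. In rank 1 the left side is 0, as
        index 1 has weight 0.\<close>
      have "\<tau> = id" using Suc True by (simp add: B_0)
      have "\<tau> \<circ> srefl q ?i \<circ> srefl a ?i \<in> B (Suc m)"
        using Suc a by (intro B_comp[of _ "Suc m"] comp_srefl_in_B srefl_in_B) auto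
      then obtain \<tau>' q' where "\<tau>' \<in> B m" "1 \<le> \<bar>q'\<bar>" "\<bar>q'\<bar> \<le> ?i"
        "\<tau> \<circ> srefl q ?i \<circ> srefl a ?i = \<tau>' \<circ> srefl q' ?i"
        using B_Suc_decompose by metis
      then show ?thesis using S Suc True
        by (simp add: moved_def del: of_nat_Suc sort_sum.simps(2))
    next
      case False
      then have "1 < ?i" by simp
      from srefl_comp_srefl_exchange[OF this Suc(2,3) a]
      obtain q' a' b' where e: "srefl q ?i \<circ> srefl a ?i = srefl a' b' \<circ> srefl q' ?i"
        and bd: "1 \<le> \<bar>q'\<bar>" "\<bar>q'\<bar> \<le> ?i" "1 \<le> \<bar>a'\<bar>" "\<bar>a'\<bar> < ?i" "1 \<le> \<bar>b'\<bar>" "\<bar>b'\<bar> < ?i"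
        and le: "of_bool (q' \<noteq> ?i) + of_bool (a' \<noteq> b') \<le> (of_bool (q \<noteq> ?i) + of_bool (a \<noteq> ?i) :: int)"
        by metis
      have eq: "\<tau> \<circ> srefl q ?i \<circ> srefl a ?i = (\<tau> \<circ> srefl a' b') \<circ> srefl q' ?i"
        using e by (simp add: comp_assoc)
      have "\<tau> \<circ> srefl a' b' \<in> B m" using Suc bd by (intro B_comp srefl_in_B) auto
      then have "sort_sum moved (Suc m) (\<tau> \<circ> srefl q ?i \<circ> srefl a ?i) =
          moved (Suc m) q' + sort_sum moved m (\<tau> \<circ> srefl a' b')"
        unfolding eq using bd S by blast
      also have "\<dots> \<le> moved (Suc m) q' + (sort_sum moved m \<tau> + of_bool (a' \<noteq> b'))"
        using IH[of a' b'] bd by simp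
      also have "\<dots> \<le> moved (Suc m) q + sort_sum moved m \<tau> + of_bool (a \<noteq> ?i)"
        using le False by (simp add: moved_def del: of_nat_Suc)
      also have "\<dots> = sort_sum moved (Suc m) (\<tau> \<circ> srefl q ?i) + of_bool (a \<noteq> ?i)"
        using S[of \<tau> q] Suc by simp
      finally show ?thesis .
    qed
    show ?case
    proof (intro allI impI)
      fix a b assume ab: "1 \<le> \<bar>a\<bar>" "\<bar>a\<bar> \<le> ?i" "1 \<le> \<bar>b\<bar>" "\<bar>b\<bar> \<le> ?i"
      consider "b = ?i" | "b = - ?i" | "a = ?i" | "a = - ?i" | "\<bar>a\<bar> < ?i" "\<bar>b\<bar> < ?i"
        using ab by linarith
      then show "sort_sum moved (Suc m) (\<tau> \<circ> srefl q ?i \<circ> srefl a b)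
        \<le> sort_sum moved (Suc m) (\<tau> \<circ> srefl q ?i) + of_bool (a \<noteq> b)"
      proof cases
        case 1
        then show ?thesis using top[of a] ab by simp
      next
        case 2
        have e: "srefl a b = srefl (- a) ?i" "(a \<noteq> b) = (- a \<noteq> ?i)"
          using srefl_minus[of "- a" ?i] 2 ab by auto
        show ?thesis unfolding e by (rule top) (use ab in simp_all)
      next
        case 3
        have e: "srefl a b = srefl b ?i" "(a \<noteq> b) = (b \<noteq> ?i)"
          using srefl_commute 3 by auto
        show ?thesis unfolding e by (rule top) (use ab in simp_all)
      next
        case 4
        have e: "srefl a b = srefl (- b) ?i" "(a \<noteq> b) = (- b \<noteq> ?i)"
          using srefl_minus[of "- b" ?i] srefl_commute[of a b] 4 ab by auto
        show ?thesis unfolding e by (rule top) (use ab in simp_all)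
      next
        case 5
        \<comment> \<open>\<open>srefl a b\<close> fixes \<open>Suc m\<close>, so \<open>q'\<close>
          equals \<open>Suc m\<close> exactly if \<open>q\<close> does, and the weight of the last
          entry is unchanged.\<close>
        define q' where "q' = srefl a b q"
        have q': "1 \<le> \<bar>q'\<bar>" "\<bar>q'\<bar> \<le> ?i" "q' = ?i \<longleftrightarrow> q = ?i"
          using 5 ab Suc by (auto simp: q'_def srefl_def)
        have "srefl a b q' = q" using ab by (auto simp: q'_def)
        moreover have "srefl a b ?i = ?i" using 5 by (auto simp: srefl_def)
        ultimately have "srefl q ?i \<circ> srefl a b = srefl a b \<circ> srefl q' ?i"
          using srefl_conjugate[of a b q' ?i] ab by auto
        then have eq: "\<tau> \<circ> srefl q ?i \<circ> srefl a b = (\<tau> \<circ> srefl a b) \<circ> srefl q' ?i"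
          by (simp add: comp_assoc)
        have "\<tau> \<circ> srefl a b \<in> B m" using Suc ab 5 by (intro B_comp srefl_in_B) auto
        moreover have "sort_sum moved m (\<tau> \<circ> srefl a b) \<le> sort_sum moved m \<tau> + of_bool (a \<noteq> b)"
          using IH[of a b] ab 5 by simp
        ultimately show ?thesis
          unfolding eq using S q' Suc by (simp add: moved_def del: of_nat_Suc sort_sum.simps(2))
      qed
    qed
  qed
  then show ?thesis using assms by blast
qed

text \<open>Index 1 has weight 0, and no other index equals 1 or -1.\<close>

lemma moved_neg1: "moved m (- 1) = moved m 1"
  by (auto simp: moved_def)

lemma sor_weight_neg1: "sor_weight m (- 1) = sor_weight m 1"
  by (simp add: sor_weight_def)

text \<open>Each element of \<open>T_D\<close> is a reflection, possibly with the sign change at 1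
  on its right, which does not affect the sum.\<close>

lemma sort_sum_moved_comp_T_D:
  assumes "\<sigma> \<in> B n" "t \<in> T_D n"
  shows "\<sigma> \<circ> t \<in> B n" "sort_sum moved n (\<sigma> \<circ> t) \<le> sort_sum moved n \<sigma> + 1"
proof -
  obtain a b where ab: "1 \<le> \<bar>a\<bar>" "\<bar>a\<bar> \<le> b" "b \<le> int n" "a \<noteq> b"
    "t = srefl a b \<or> t = srefl a b \<circ> srefl (- 1) 1"
  proof -
    from assms(2) consider i j where "t = srefl i j" "1 \<le> \<bar>i\<bar>" "\<bar>i\<bar> < j" "j \<le> int n"
      | i where "t = srefl (- i) i \<circ> srefl (- 1) 1" "1 < i" "i \<le> int n"
      unfolding T_D_def by blast
    then show thesis
    proof cases
      case 1
      then show thesis by (intro that[of i j]) auto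
    next
      case 2
      then show thesis by (intro that[of "- i" i]) auto
    qed
  qed
  have s: "srefl (- 1) 1 \<in> B n" using ab by (intro srefl_in_B) auto
  have B: "\<sigma> \<circ> srefl a b \<in> B n" using assms ab by (intro B_comp srefl_in_B) auto
  then show "\<sigma> \<circ> t \<in> B n" using ab(5) B_comp s by (auto simp: comp_assoc[symmetric])
  have "sort_sum moved n (\<sigma> \<circ> t) = sort_sum moved n (\<sigma> \<circ> srefl a b)"
    using ab sort_sum_comp_neg1[where f = moved, OF B _ moved_neg1] by (auto simp: comp_assoc)
  then show "sort_sum moved n (\<sigma> \<circ> t) \<le> sort_sum moved n \<sigma> + 1"
    using sort_sum_moved_comp_srefl[OF assms(1), of a b] ab by simp
qed

text \<open>The lower bound for the length: the sum is 0 at the identity and each factor adds at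
  most 1.\<close>

lemma sort_sum_moved_le_length:
  assumes "set ts \<subseteq> T_D n"
  shows "comp_list ts \<in> B n \<and> sort_sum moved n (comp_list ts) \<le> int (length ts)"
  using assms
proof (induction ts rule: rev_induct)
  case Nil
  have "sort_sum moved n id = 0" by (rule sort_sum_id) (simp add: moved_def)
  then show ?case by (simp add: id_in_B flip: id_def)
next
  case (snoc t ts)
  have eq: "comp_list (ts @ [t]) = comp_list ts \<circ> t" by (simp add: comp_list_append)
  have "comp_list ts \<circ> t \<in> B n"
    and "sort_sum moved n (comp_list ts \<circ> t) \<le> int (length (ts @ [t]))"
    using sort_sum_moved_comp_T_D[of "comp_list ts" n t] snoc by auto
  then show ?case unfolding eq by blast
qed

text \<open>The bound is attained: F-code factors with \<open>q\<close> different from the top index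
  lie in \<open>T_D\<close> and have weight 1, the others are the identity and are left out.\<close>

lemma T_D_factorization:
  assumes "\<sigma> \<in> D n" "n \<ge> 1"
  shows "\<exists>ts. int (length ts) = sort_sum moved n \<sigma> \<and> set ts \<subseteq> T_D n \<and> \<sigma> = comp_list ts"
  using assms
proof (induction rule: D_induct)
  case one
  have "sort_sum moved (Suc 0) id = 0" by (rule sort_sum_id) (simp add: moved_def)
  then show ?case by (intro exI[of _ "[]"]) (simp del: sort_sum.simps(2) flip: id_def)
next
  case (Suc m \<tau> q)
  let ?i = "int (Suc m)"
  obtain ts where ts: "int (length ts) = sort_sum moved m \<tau>" "set ts \<subseteq> T_D m" "\<tau> = comp_list ts"
    using Suc by blast
  have mono: "T_D m \<subseteq> T_D (Suc m)" unfolding T_D_def by fastforce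
  have S: "sort_sum moved (Suc m) (\<tau> \<circ> F_factor q ?i) = moved (Suc m) q + sort_sum moved m \<tau>"
    using Suc D_subset_B sort_sum_comp_F_factor[where f = moved, OF _ _ _ _ moved_neg1] by blast
  show ?case
  proof (cases "q = ?i")
    case True
    then have "F_factor q ?i = id" by (auto simp: F_factor_def)
    then have "\<tau> \<circ> F_factor q ?i = comp_list ts" using ts by simp
    moreover have "moved (Suc m) q = 0" using True by (simp add: moved_def)
    ultimately show ?thesis using ts mono S by auto
  next
    case False
    have "F_factor q ?i \<in> T_D (Suc m)"
    proof (cases "q = - ?i")
      case True
      then have "F_factor q ?i = srefl (- ?i) ?i \<circ> srefl (- 1) 1" by (simp add: F_factor_def)
      moreover have "1 < ?i" using Suc.hyps by simp
      ultimately show ?thesis unfolding T_D_def by blast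
    next
      case neg: False
      then have "\<bar>q\<bar> < ?i" using Suc False by linarith
      then show ?thesis using Suc neg unfolding F_factor_def T_D_def by auto
    qed
    then have "set (ts @ [F_factor q ?i]) \<subseteq> T_D (Suc m)" using ts mono by auto
    moreover have "\<tau> \<circ> F_factor q ?i = comp_list (ts @ [F_factor q ?i])"
      using ts by (simp add: comp_list_append)
    moreover have "moved (Suc m) q = 1" using False Suc.hyps by (simp add: moved_def)
    then have "int (length (ts @ [F_factor q ?i])) = sort_sum moved (Suc m) (\<tau> \<circ> F_factor q ?i)"
      using S ts by simp
    ultimately show ?thesis by blast
  qed
qed

lemma l_D_eq_sort_sum:
  assumes "\<sigma> \<in> D n" "n \<ge> 1"
  shows "int (l_D n \<sigma>) = sort_sum moved n \<sigma>"
proof -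
  obtain ts where ts: "int (length ts) = sort_sum moved n \<sigma>" "set ts \<subseteq> T_D n" "\<sigma> = comp_list ts"
    using T_D_factorization assms by blast
  have "l_D n \<sigma> = length ts"
    unfolding l_D_def
  proof (rule Least_equality)
    fix k assume "\<exists>us. length us = k \<and> set us \<subseteq> T_D n \<and> \<sigma> = comp_list us"
    then show "length ts \<le> k" using sort_sum_moved_le_length ts(1) by fastforce
  qed (use ts in blast)
  then show ?thesis using ts by simp
qed

section \<open>The statistics of a word\<close>

fun count_pairs :: "('a \<Rightarrow> 'a \<Rightarrow> bool) \<Rightarrow> 'a list \<Rightarrow> nat" where
  "count_pairs P [] = 0"
| "count_pairs P (x # xs) = length (filter (P x) xs) + count_pairs P xs"

lemma count_pairs_insert:
  "count_pairs P (us @ x # vs) =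
     count_pairs P (us @ vs) + length (filter (\<lambda>u. P u x) us) + length (filter (P x) vs)"
  by (induction us) auto

definition inv_word :: "int list \<Rightarrow> nat" where
  "inv_word w = count_pairs (\<lambda>x y. x > y) w + count_pairs (\<lambda>x y. - x > y) w"

fun nmin_word :: "int list \<Rightarrow> nat" where
  "nmin_word [] = 0"
| "nmin_word (x # xs) = of_bool (\<exists>y\<in>set xs. x > \<bar>y\<bar>) + of_bool (x < - 1) + nmin_word xs"

text \<open>No entry on the left exceeds \<open>\<bar>x\<bar>\<close>, so the new entry cannot make
  any of them count; only the contribution of \<open>x\<close> itself is added.\<close>

lemma nmin_word_insert:
  assumes "\<forall>u\<in>set us. u \<le> \<bar>x\<bar>"
  shows "nmin_word (us @ x # vs) =
    nmin_word (us @ vs) + of_bool (\<exists>y\<in>set vs. x > \<bar>y\<bar>) + of_bool (x < - 1)"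
  using assms by (induction us) auto

text \<open>The pairs with first component \<open>a\<close> are split off. The bounds are general
  because the recursion of \<open>[a..b]\<close> raises the lower one.\<close>

lemma count_pairs_map_upto:
  "card {(i, j). a \<le> i \<and> i < j \<and> j \<le> b \<and> P (\<sigma> i) (\<sigma> j)} = count_pairs P (map \<sigma> [a..b])"
proof (induction a b rule: upto.induct)
  case (1 a b)
  show ?case
  proof (cases "a \<le> b")
    case True
    let ?S = "\<lambda>a. {(i, j). a \<le> i \<and> i < j \<and> j \<le> b \<and> P (\<sigma> i) (\<sigma> j)}"
    let ?J = "{j \<in> {a + 1..b}. P (\<sigma> a) (\<sigma> j)}"
    have split: "?S a = Pair a ` ?J \<union> ?S (a + 1)"
    proof (rule set_eqI)
      fix p :: "int \<times> int"
      obtain i j where p: "p = (i, j)" by fastforce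
      show "p \<in> ?S a \<longleftrightarrow> p \<in> Pair a ` ?J \<union> ?S (a + 1)"
        unfolding p by (cases "i = a") auto
    qed
    have "?S (a + 1) \<subseteq> {a..b} \<times> {a..b}" by auto
    then have "finite (?S (a + 1))" by (rule finite_subset) simp
    then have "card (?S a) = card (Pair a ` ?J) + card (?S (a + 1))"
      unfolding split
      by (intro card_Un_disjoint finite_imageI) (auto intro: finite_subset[of _ "{a + 1..b}"])
    also have "card (Pair a ` ?J) = card ?J" by (intro card_image) (auto simp: inj_on_def)
    also have "\<dots> = card (set (filter (\<lambda>j. P (\<sigma> a) (\<sigma> j)) [a + 1..b]))"
      by (intro arg_cong[of _ _ card]) auto
    also have "\<dots> = length (filter (P (\<sigma> a)) (map \<sigma> [a + 1..b]))"
      by (subst distinct_card) (auto simp: filter_map o_def)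
    finally show ?thesis using 1 True by (simp add: upto_rec1)
  next
    case False
    then have empty: "{(i, j). a \<le> i \<and> i < j \<and> j \<le> b \<and> P (\<sigma> i) (\<sigma> j)} = {}" by auto
    show ?thesis unfolding empty using False by simp
  qed
qed

lemma inv_D_eq_inv_word: "inv_D n \<sigma> = inv_word (word n \<sigma>)"
  unfolding inv_D_def inv_word_def word_def count_pairs_map_upto[symmetric] ..

lemma nmin_word_map_upto:
  "card {i \<in> {a..b}. \<exists>j. i < j \<and> j \<le> b \<and> \<sigma> i > \<bar>\<sigma> j\<bar>} + card {i \<in> {a..b}. \<sigma> i < - 1} =
     nmin_word (map \<sigma> [a..b])"
proof (induction a b rule: upto.induct)
  case (1 a b)
  show ?case
  proof (cases "a \<le> b")
    case True
    have card: "card {i \<in> {a..b}. P i} = of_bool (P a) + card {i \<in> {a + 1..b}. P i}" for P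
    proof -
      define S where "S = {i \<in> {a + 1..b}. P i}"
      have "{i \<in> {a..b}. P i} = (if P a then insert a S else S)"
        using True by (auto simp: S_def le_less)
      moreover have "finite S" "a \<notin> S" unfolding S_def by (auto intro: finite_subset[of _ "{a + 1..b}"])
      ultimately show ?thesis unfolding S_def[symmetric] by simp
    qed
    have "(\<exists>j. a < j \<and> j \<le> b \<and> \<sigma> a > \<bar>\<sigma> j\<bar>) \<longleftrightarrow> (\<exists>y\<in>set (map \<sigma> [a + 1..b]). \<sigma> a > \<bar>y\<bar>)"
      by (auto simp: add1_zle_eq)
    then show ?thesis using 1 True unfolding card by (simp add: upto_rec1)
  qed simp
qed

lemma nmin_D_eq_nmin_word: "nmin_D n \<sigma> = nmin_word (word n \<sigma>)"
  unfolding nmin_D_def word_def nmin_word_map_upto[symmetric] ..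

section \<open>The E-code\<close>

text \<open>These lists are the words of the elements of \<open>B n\<close>.\<close>

definition signed_word :: "nat \<Rightarrow> int list \<Rightarrow> bool" where
  "signed_word n w \<longleftrightarrow> distinct (map abs w) \<and> abs ` set w = {1..int n}"

lemma signed_word_length: "signed_word n w \<Longrightarrow> length w = n"
  unfolding signed_word_def
  by (metis card_atLeastAtMost_int diff_add_cancel distinct_card length_map list.set_map nat_int)

lemma signed_word_negate_first: "signed_word n (negate_first w) \<longleftrightarrow> signed_word n w"
  by (cases w) (auto simp: signed_word_def)

lemma signed_word_insert:
  assumes "\<bar>x\<bar> = int (Suc m)"
  shows "signed_word (Suc m) (us @ x # vs) \<longleftrightarrow> signed_word m (us @ vs)"
proof -
  have ins: "{1..int (Suc m)} = insert (int (Suc m)) {1..int m}" by auto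
  have "distinct (map abs (us @ x # vs)) \<longleftrightarrow>
      \<bar>x\<bar> \<notin> abs ` set (us @ vs) \<and> distinct (map abs (us @ vs))"
    by auto
  moreover have "abs ` set (us @ x # vs) = insert (int (Suc m)) (abs ` set (us @ vs))"
    using assms by auto
  moreover have "int (Suc m) \<notin> {1..int m}" by auto
  ultimately show ?thesis unfolding signed_word_def ins assms by (metis insert_ident)
qed

text \<open>Negating the first entry interchanges its contributions to the two counts.\<close>

lemma inv_word_negate_first: "inv_word (negate_first w) = inv_word w"
  by (cases w) (simp_all add: inv_word_def)

text \<open>A first entry of absolute value above 1 contributes exactly 1 with either sign: if
  positive, because 1 or -1 stands further right, and if negative, because it is below -1. An entry
  1 or -1 contributes 0.\<close>

lemma nmin_word_negate_first:
  assumes "signed_word n w"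
  shows "nmin_word (negate_first w) = nmin_word w"
proof (cases w)
  case (Cons x xs)
  have bound: "1 \<le> \<bar>y\<bar>" if "y \<in> set w" for y
    using assms that unfolding signed_word_def by (metis atLeastAtMost_iff imageI)
  have "\<exists>y\<in>set xs. \<bar>y\<bar> < \<bar>x\<bar>" if "\<bar>x\<bar> > 1"
  proof -
    have "\<bar>x\<bar> \<in> {1..int n}" using assms Cons unfolding signed_word_def by fastforce
    then have "1 \<in> abs ` set w" using assms unfolding signed_word_def by auto
    then show ?thesis using that Cons by force
  qed
  moreover have "\<not> (\<exists>y\<in>set xs. \<bar>y\<bar> < \<bar>x\<bar>)" if "\<bar>x\<bar> \<le> 1"
    using bound that Cons by fastforce
  moreover have "x \<noteq> 0" using bound[of x] Cons by auto
  ultimately show ?thesis unfolding Cons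
    by (cases "x > 0"; cases "\<bar>x\<bar> > 1") (auto simp: abs_if split: if_splits)
qed simp

lemma position_append: "x \<notin> set us \<Longrightarrow> position x (us @ x # vs) = Suc (length us)"
  unfolding position_def by (subst takeWhile_append2) auto

text \<open>The deleted entry has the largest absolute value, so its sign decides all comparisons.
  At position \<open>p\<close>, a positive one forms one inversion with each entry to its right,
  \<open>Suc m - p\<close> in all; a negative one forms two with each entry to its left and one with
  each to its right, \<open>Suc m + p - 2\<close> in all. For \<open>nmin_word\<close> it counts
  unless it is positive and last.\<close>

lemma E_word_remove:
  assumes w: "signed_word (Suc m) w" and "m \<ge> 1"
  obtains u q where "signed_word m u" "1 \<le> \<bar>q\<bar>" "\<bar>q\<bar> \<le> int (Suc m)"
    "E_word (Suc m) w = E_word m u @ [q]"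
    "int (inv_word w) = sor_weight (Suc m) q + int (inv_word u)"
    "int (nmin_word w) = moved (Suc m) q + int (nmin_word u)"
proof -
  let ?i = "int (Suc m)"
  obtain k where k: "m = Suc k" using assms(2) by (cases m) auto
  have "?i \<in> abs ` set w" using w unfolding signed_word_def by auto
  then have "\<exists>x\<in>set w. \<bar>x\<bar> = ?i" by force
  \<comment> \<open>The positive entry is preferred, matching the order of the tests in
    \<open>E_word\<close>.\<close>
  then obtain x where x: "x \<in> set w" "\<bar>x\<bar> = ?i" and pref: "?i \<in> set w \<longrightarrow> x = ?i"
    by (metis abs_of_nat)
  obtain us vs where split: "w = us @ x # vs" and nin: "x \<notin> set us"
    using split_list_first[OF x(1)] by blast
  have uv: "signed_word m (us @ vs)"
    using w x(2) unfolding split by (simp only: signed_word_insert)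
  have len: "length us + length vs = m" using signed_word_length[OF uv] by simp
  have bound: "\<bar>y\<bar> < ?i" if "y \<in> set us \<union> set vs" for y
  proof -
    have "\<bar>y\<bar> \<in> {1..int m}" using uv that unfolding signed_word_def by (metis imageI set_append)
    then show ?thesis by simp
  qed
  have rem: "remove1 x w = us @ vs" using nin by (simp add: split remove1_append)
  have pos: "position x w = Suc (length us)" using nin by (simp add: split position_append)
  have inv: "inv_word w = inv_word (us @ vs)
      + length (filter (\<lambda>u. u > x) us) + length (filter (\<lambda>y. x > y) vs)
      + length (filter (\<lambda>u. - u > x) us) + length (filter (\<lambda>y. - x > y) vs)"
    unfolding inv_word_def split count_pairs_insert by simp
  have nmin: "nmin_word w = nmin_word (us @ vs) + of_bool (\<exists>y\<in>set vs. x > \<bar>y\<bar>) + of_bool (x < - 1)"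
    unfolding split using bound x by (intro nmin_word_insert) fastforce
  show thesis
  proof (cases "?i \<in> set w")
    case True
    then have xi: "x = ?i" using pref by blast
    let ?q = "int (Suc (length us))"
    have "\<forall>y\<in>set us. \<not> y > x \<and> \<not> - y > x" "\<forall>y\<in>set vs. x > y \<and> \<not> - x > y"
      using bound xi by fastforce+
    then have "length (filter (\<lambda>u. u > x) us) = 0" "length (filter (\<lambda>u. - u > x) us) = 0"
      "length (filter (\<lambda>y. x > y) vs) = length vs" "length (filter (\<lambda>y. - x > y) vs) = 0"
      by (auto simp: filter_empty_conv intro!: arg_cong[of _ _ length] filter_True)
    then have "int (inv_word w) = sor_weight (Suc m) ?q + int (inv_word (us @ vs))"
      using inv len by (simp add: sor_weight_def)
    moreover have "(\<exists>y\<in>set vs. x > \<bar>y\<bar>) \<longleftrightarrow> vs \<noteq> []"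
      using bound xi by (cases vs) auto
    then have "int (nmin_word w) = moved (Suc m) ?q + int (nmin_word (us @ vs))"
      using nmin len xi assms(2) by (auto simp: moved_def)
    moreover have "E_word (Suc m) w = E_word m (us @ vs) @ [?q]"
      using True rem pos unfolding xi k by (simp del: of_nat_Suc add: Let_def)
    ultimately show thesis using len by (intro that[OF uv, of ?q]) auto
  next
    case False
    then have xi: "x = - ?i" using x by (auto simp: abs_if split: if_splits)
    let ?q = "- int (Suc (length us))"
    \<comment> \<open>The sign change after the deletion leaves both statistics as they are.\<close>
    let ?u = "negate_first (us @ vs)"
    have "\<forall>y\<in>set us. y > x \<and> - y > x" "\<forall>y\<in>set vs. \<not> x > y \<and> - x > y"
      using bound xi by fastforce+
    then have "length (filter (\<lambda>u. u > x) us) = length us" "length (filter (\<lambda>u. - u > x) us) = length us"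
      "length (filter (\<lambda>y. x > y) vs) = 0" "length (filter (\<lambda>y. - x > y) vs) = length vs"
      by (auto simp: filter_empty_conv intro!: arg_cong[of _ _ length] filter_True)
    then have "int (inv_word w) = sor_weight (Suc m) ?q + int (inv_word ?u)"
      using inv len by (simp add: sor_weight_def inv_word_negate_first)
    moreover have "\<not> (\<exists>y\<in>set vs. x > \<bar>y\<bar>)" using xi by auto
    then have "int (nmin_word w) = moved (Suc m) ?q + int (nmin_word ?u)"
      using nmin len xi assms(2) nmin_word_negate_first[OF uv] by (simp add: moved_def)
    moreover have "E_word (Suc m) w = E_word m ?u @ [?q]"
      using False rem pos unfolding xi k by (simp del: of_nat_Suc negate_first.simps add: Let_def)
    moreover have "signed_word m ?u" using uv by (simp add: signed_word_negate_first)
    ultimately show thesis using len by (intro that[of ?u ?q]) auto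
  qed
qed

text \<open>The preimage under the F-code is built by multiplying with one \<open>F_factor\<close>
  per entry of the E-code. Statistics and sums then obey the same recursion with the same
  weights.\<close>

lemma E_word_eq_F_code:
  assumes "signed_word n w" "n \<ge> 1"
  shows "\<exists>\<tau>\<in>D n. F_code n \<tau> = E_word n w \<and>
    int (inv_word w) = sort_sum sor_weight n \<tau> \<and> int (nmin_word w) = sort_sum moved n \<tau>"
  using assms(2,1)
proof (induction n arbitrary: w rule: nat_induct_at_least)
  case base
  \<comment> \<open>The word is \<open>[1]\<close> or \<open>[- 1]\<close>; both have code
    \<open>[1]\<close> and both statistics 0.\<close>
  have "sort_sum moved 1 id = 0" "sort_sum sor_weight 1 id = 0"
    by (rule sort_sum_id; simp add: moved_def sor_weight_def)+
  moreover obtain x where "w = [x]"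
    using signed_word_length[OF base] by (auto simp: length_Suc_conv)
  moreover from this have "\<bar>x\<bar> = 1" using base by (auto simp: signed_word_def)
  ultimately show ?case
    by (intro bexI[of _ id]) (auto simp: id_in_D inv_word_def simp del: sort_sum.simps simp flip: id_def)
next
  case (Suc m)
  obtain u q where u: "signed_word m u" and q: "1 \<le> \<bar>q\<bar>" "\<bar>q\<bar> \<le> int (Suc m)"
    and E: "E_word (Suc m) w = E_word m u @ [q]"
    and inv: "int (inv_word w) = sor_weight (Suc m) q + int (inv_word u)"
    and nmin: "int (nmin_word w) = moved (Suc m) q + int (nmin_word u)"
    using E_word_remove[OF Suc.prems Suc.hyps] by blast
  obtain \<tau> where \<tau>: "\<tau> \<in> D m" "F_code m \<tau> = E_word m u"
    "int (inv_word u) = sort_sum sor_weight m \<tau>" "int (nmin_word u) = sort_sum moved m \<tau>"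
    using Suc.IH[OF u] by blast
  let ?\<sigma> = "\<tau> \<circ> F_factor q (int (Suc m))"
  have "F_code (Suc m) ?\<sigma> = E_word (Suc m) w"
    using F_code_comp_F_factor[OF \<tau>(1) Suc.hyps q] \<tau> E by metis
  moreover have "sort_sum f (Suc m) ?\<sigma> = f (Suc m) q + sort_sum f m \<tau>"
    if "\<And>m. f m (- 1) = f m 1" for f
    using sort_sum_comp_F_factor[OF D_subset_B[OF \<tau>(1)] Suc.hyps q] that by blast
  then have "int (inv_word w) = sort_sum sor_weight (Suc m) ?\<sigma>"
    "int (nmin_word w) = sort_sum moved (Suc m) ?\<sigma>"
    using inv nmin \<tau> sor_weight_neg1 moved_neg1 by metis+
  ultimately show ?case using comp_F_factor_in_D[OF \<tau>(1) Suc.hyps q] by blast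
qed

section \<open>Back from words to signed permutations\<close>

lemma signed_word_word:
  assumes "\<sigma> \<in> B n"
  shows "signed_word n (word n \<sigma>)"
proof -
  have inj: "inj_on (\<lambda>i. \<bar>\<sigma> i\<bar>) {1..int n}"
  proof (rule inj_onI)
    fix x y assume xy: "x \<in> {1..int n}" "y \<in> {1..int n}" "\<bar>\<sigma> x\<bar> = \<bar>\<sigma> y\<bar>"
    then have "\<sigma> x = \<sigma> y \<or> \<sigma> x = \<sigma> (- y)" using B_minus[OF assms] by (auto simp: abs_eq_iff)
    then show "x = y" using xy B_inj[OF assms] by auto
  qed
  moreover have "(\<lambda>i. \<bar>\<sigma> i\<bar>) ` {1..int n} \<subseteq> {1..int n}"
    using B_range[OF assms] by fastforce
  ultimately have "(\<lambda>i. \<bar>\<sigma> i\<bar>) ` {1..int n} = {1..int n}"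
    by (simp add: endo_inj_surj)
  then show ?thesis using inj
    by (simp add: signed_word_def word_def distinct_map image_image comp_inj_on_iff[symmetric] o_def)
qed

theorem theorem4p6:
  fixes n :: nat and \<sigma> :: "int \<Rightarrow> int"
  assumes "n \<ge> 2" and "\<sigma> \<in> D n"
  shows "int (inv_D n \<sigma>) = sor_D n (rho n \<sigma>) \<and> nmin_D n \<sigma> = l_D n (rho n \<sigma>)"
proof -
  have n: "n \<ge> 1" using assms by simp
  obtain \<tau> where \<tau>: "\<tau> \<in> D n" "F_code n \<tau> = E_code n \<sigma>"
    "int (inv_D n \<sigma>) = sort_sum sor_weight n \<tau>" "int (nmin_D n \<sigma>) = sort_sum moved n \<tau>"
    using E_word_eq_F_code[OF signed_word_word[OF D_subset_B[OF assms(2)]] n]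
    unfolding E_code_def inv_D_eq_inv_word nmin_D_eq_nmin_word by blast
  have "rho n \<sigma> = \<tau>"
    unfolding rho_def using \<tau>(1,2) the_inv_into_f_f[OF F_code_inj_on[OF n]] by metis
  then show ?thesis
    using \<tau> sor_D_eq_sort_sum[OF D_subset_B[OF \<tau>(1)]] l_D_eq_sort_sum[OF \<tau>(1) n] by simp
qed

end
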